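(* Let $(\mathcal X,\mathcal A)$ be a measurable space, let $\mathcal P\subseteq\mathrm{Prob}(\mathcal X,\mathcal A)$ be a model and let $I$ be a set. For each $i\in I$, let $\mathcal C_i$ be a sub-$\sigma$-algebra of $\mathcal A$ and let $(\mathcal P_{i,\eta}:\eta\in H_i)$ be an exhaustion of $\mathcal P$ such that $\mathcal C_i$ is complete and sufficient for each $\mathcal P_{i,\eta}$, $\eta\in H_i$. Then $\bigvee_{i\in I}\mathcal C_i$ is complete for $\mathcal P$.
   Context: $\mathrm{Prob}(\mathcal X,\mathcal A)$ denotes the set of all probability measures (laws) on $(\mathcal X,\mathcal A)$. A model on $(\mathcal X,\mathcal A)$ is a subset $\mathcal P\subseteq\mathrm{Prob}(\mathcal X,\mathcal A)$; a submodel is a subset of $\mathcal P$. An exhaustion of $\mathcal P$ is a family $(\mathcal P_\eta:\eta\in H)$ of submodels of $\mathcal P$ with $\bigcup_{\eta\in H}\mathcal P_\eta=\mathcal P$. For a law $P$ and a function $h$, $Ph$ denotes $\int h\,dP$. A sub-$\sigma$-algebra $\mathcal C\subseteq\mathcal A$ is complete for a model $\mathcal P$ if every $\mathcal C$-measurable $h:\mathcal X\to\mathbb R$ that is integrable with respect to every $P\in\mathcal P$ and satisfies $Ph=0$ for all $P\in\mathcal P$ also satisfies $h=0$ $P$-a.s. for every $P\in\mathcal P$. A sub-$\sigma$-algebra $\mathcal C$ is sufficient for $\mathcal P$ if for every $A\in\mathcal A$ there is a $\mathcal C$-measurable function that is a version of the conditional probability $P(A\,|\,\mathcal C)$ simultaneously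 for all $P\in\mathcal P$. $\bigvee_{i\in I}\mathcal C_i$ denotes the smallest sub-$\sigma$-algebra of $\mathcal A$ containing every $\mathcal C_i$. *)

theory Defs
  imports "HOL-Probability.Probability"
begin

text \<open>
  Sub-\<open>\<sigma>\<close>-algebras of a measurable space are represented, as in the library's predicate
  \<^const>\<open>subalgebra\<close>, by values of type \<^typ>\<open>'a measure\<close> of which only the space and the
  measurable sets matter. \<open>space (prob_algebra M)\<close> is the set of all laws on the measurable
  space \<open>M\<close>.
\<close>

definition model :: "'a measure \<Rightarrow> 'a measure set \<Rightarrow> bool" where
  "model M \<P> \<longleftrightarrow> \<P> \<subseteq> space (prob_algebra M)"

definition exhaustion :: "'a measure set \<Rightarrow> 'h set \<Rightarrow> ('h \<Rightarrow> 'a measure set) \<Rightarrow> bool" where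
  "exhaustion \<P> H \<Q> \<longleftrightarrow> (\<forall>\<eta>\<in>H. \<Q> \<eta> \<subseteq> \<P>) \<and> (\<Union>\<eta>\<in>H. \<Q> \<eta>) = \<P>"

definition complete_for :: "'a measure \<Rightarrow> 'a measure set \<Rightarrow> bool" where
  "complete_for C \<P> \<longleftrightarrow>
    (\<forall>h :: 'a \<Rightarrow> real. h \<in> borel_measurable C \<longrightarrow>
       (\<forall>P\<in>\<P>. integrable P h) \<longrightarrow> (\<forall>P\<in>\<P>. (\<integral>x. h x \<partial>P) = 0) \<longrightarrow>
       (\<forall>P\<in>\<P>. AE x in P. h x = 0))"

definition cond_prob_version :: "'a measure \<Rightarrow> 'a measure \<Rightarrow> 'a set \<Rightarrow> ('a \<Rightarrow> real) \<Rightarrow> bool" where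
  "cond_prob_version P C A f \<longleftrightarrow>
    f \<in> borel_measurable C \<and> (AE x in P. f x = real_cond_exp P C (indicator A) x)"

text \<open>The usual defining property of a version of the conditional probability.\<close>

lemma cond_prob_version_iff:
  assumes "prob_space P" "subalgebra P C" "A \<in> sets P"
  shows "cond_prob_version P C A f \<longleftrightarrow>
    f \<in> borel_measurable C \<and> integrable P f \<and>
    (\<forall>B\<in>sets C. (\<integral>x\<in>B. f x \<partial>P) = measure P (A \<inter> B))"
proof -
  interpret prob_space P by fact
  interpret finite_measure_subalgebra P C
    by (rule finite_measure_subalgebra.intro) (unfold_locales, rule assms(2))
  have BP: "B \<in> sets P" if "B \<in> sets C" for B
    using assms(2) that by (auto simp: subalgebra_def)
  have int: "integrable P (indicator A :: _ \<Rightarrow> real)"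
    using assms(3) by (simp add: integrable_indicator_iff emeasure_eq_measure)
  have ind: "(\<integral>x\<in>B. indicator A x \<partial>P) = measure P (A \<inter> B)" if "B \<in> sets C" for B
  proof -
    have "(\<integral>x\<in>B. indicator A x \<partial>P) = (\<integral>x. indicator (A \<inter> B) x \<partial>P)"
      unfolding set_lebesgue_integral_def
      by (rule Bochner_Integration.integral_cong) (auto simp: indicator_def)
    also have "\<dots> = measure P (A \<inter> B \<inter> space P)" by simp
    also have "A \<inter> B \<inter> space P = A \<inter> B" using assms(3) sets.sets_into_space by blast
    finally show ?thesis .
  qed
  show ?thesis
  proof
    assume v: "cond_prob_version P C A f"
    then have fC: "f \<in> borel_measurable C"
      and ae: "AE x in P. f x = real_cond_exp P C (indicator A) x"
      by (auto simp: cond_prob_version_def)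
    have fP: "f \<in> borel_measurable P" using measurable_from_subalg[OF assms(2) fC] .
    have "integrable P f"
      using integrable_cong_AE[OF fP borel_measurable_cond_exp2 ae] real_cond_exp_int(1)[OF int] by simp
    moreover have "(\<integral>x\<in>B. f x \<partial>P) = measure P (A \<inter> B)" if B: "B \<in> sets C" for B
    proof -
      have "(\<integral>x\<in>B. f x \<partial>P) = (\<integral>x\<in>B. real_cond_exp P C (indicator A) x \<partial>P)"
        unfolding set_lebesgue_integral_def
        by (rule integral_cong_AE) (use fP BP[OF B] ae in auto)
      also have "\<dots> = (\<integral>x\<in>B. indicator A x \<partial>P)"
        using real_cond_exp_intA[OF int B] by simp
      finally show ?thesis using ind[OF B] by simp
    qed
    ultimately show "f \<in> borel_measurable C \<and> integrable P f \<and>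
        (\<forall>B\<in>sets C. (\<integral>x\<in>B. f x \<partial>P) = measure P (A \<inter> B))"
      using fC by blast
  next
    assume r: "f \<in> borel_measurable C \<and> integrable P f \<and>
        (\<forall>B\<in>sets C. (\<integral>x\<in>B. f x \<partial>P) = measure P (A \<inter> B))"
    have "AE x in P. real_cond_exp P C (indicator A) x = f x"
      by (rule real_cond_exp_charact) (use r int ind in auto)
    with r show "cond_prob_version P C A f" by (auto simp: cond_prob_version_def)
  qed
qed

definition sufficient_for :: "'a measure \<Rightarrow> 'a measure \<Rightarrow> 'a measure set \<Rightarrow> bool" where
  "sufficient_for M C \<P> \<longleftrightarrow>
    (\<forall>A\<in>sets M. \<exists>f :: 'a \<Rightarrow> real. f \<in> borel_measurable C \<and> (\<forall>P\<in>\<P>. cond_prob_version P C A f))"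

text \<open>
  The space is taken from \<open>M\<close>, so that for empty \<open>I\<close> this is the trivial \<open>\<sigma>\<close>-algebra on
  \<open>space M\<close>; the supremum \<open>SUP i\<in>I. C i\<close> of the library would then have empty space.
\<close>

definition sigma_join :: "'a measure \<Rightarrow> 'i set \<Rightarrow> ('i \<Rightarrow> 'a measure) \<Rightarrow> 'a measure" where
  "sigma_join M I C = sigma (space M) (\<Union>i\<in>I. sets (C i))"

end

theory Submission
  imports Defs
begin

text \<open>
  The proof rests on the class of \<^emph>\<open>unbiased estimators of zero\<close>: the measurable functions that are
  integrable with mean \<open>0\<close> under every law of the model. Call an event \<open>A\<close> \<^emph>\<open>neutral\<close> if
  multiplication by the indicator of \<open>A\<close> maps this class into itself. Two observations give the
  theorem.

  Every event of \<open>C i\<close> is neutral. Indeed, if \<open>h\<close> is an unbiased estimator of zero, then by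
  sufficiency there is, for each \<open>\<eta>\<close>, a single version \<open>g\<close> of \<open>E\<^sub>P(h | C i)\<close> for all
  \<open>P \<in> \<Q> i \<eta>\<close>; it has mean \<open>0\<close> under these \<open>P\<close>, so by completeness it vanishes almost surely,
  and the integral of \<open>h\<close> over any event of \<open>C i\<close> is \<open>0\<close>. As the submodels exhaust \<open>\<P>\<close>, this
  holds under every \<open>P \<in> \<P>\<close>. The conclusion no longer mentions \<open>\<eta>\<close>, which is why different
  exhaustions for different \<open>i\<close> do no harm.

  The neutral events form a \<open>\<sigma>\<close>-algebra. Since neutrality speaks of \<^emph>\<open>all\<close> unbiased estimators of
  zero, it can be applied twice in a row, and so it passes to intersections; complements and
  disjoint unions follow from additivity of the integral. Hence all events of the join are neutral
  (\<open>sigma_join_neutral\<close>). If \<open>h\<close> is an unbiased estimator of zero that is measurable with respect to the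
  join, then the events \<open>h > 0\<close> and \<open>h < 0\<close> are neutral, so the positive and negative parts of
  \<open>h\<close> have integral \<open>0\<close> and \<open>h\<close> vanishes almost surely.
\<close>

section \<open>Common versions of conditional expectations under sufficiency\<close>

lemma subalgebra_law:
  assumes "subalgebra M C" "P \<in> space (prob_algebra M)"
  shows "subalgebra P C"
proof -
  have "sets P = sets M" using assms(2) by (auto simp: space_prob_algebra)
  with sets_eq_imp_space_eq[OF this] assms(1) show ?thesis by (simp add: subalgebra_def)
qed

lemma nn_integral_cond_prob_version:
  assumes P: "prob_space P" "subalgebra P C" "A \<in> sets P" and f: "cond_prob_version P C A f"
    and B: "B \<in> sets C"
  shows "(\<integral>\<^sup>+x\<in>B. ennreal (f x) \<partial>P) = (\<integral>\<^sup>+x\<in>B. indicator A x \<partial>P)"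
proof -
  interpret prob_space P by fact
  interpret finite_measure_subalgebra P C
    by (rule finite_measure_subalgebra.intro) (unfold_locales, rule P(2))
  have BP: "B \<in> sets P" using P(2) B by (auto simp: subalgebra_def)
  have f': "f \<in> borel_measurable C" "integrable P f"
      "\<And>B. B \<in> sets C \<Longrightarrow> (\<integral>x\<in>B. f x \<partial>P) = measure P (A \<inter> B)"
    using f cond_prob_version_iff[OF P] by auto
  have "AE x in P. real_cond_exp P C (indicator A) x \<ge> 0"
    by (rule real_cond_exp_pos) (use P(3) in auto)
  moreover have "AE x in P. f x = real_cond_exp P C (indicator A) x"
    using f by (simp add: cond_prob_version_def)
  ultimately have pos: "AE x in P. 0 \<le> f x"
    by eventually_elim simp
  then have posB: "AE x in P. 0 \<le> indicator B x * f x"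
    by eventually_elim simp
  have "(\<integral>\<^sup>+x\<in>B. ennreal (f x) \<partial>P) = (\<integral>\<^sup>+x. ennreal (indicator B x * f x) \<partial>P)"
    by (rule nn_integral_cong) (auto simp: indicator_def)
  also have "\<dots> = ennreal (\<integral>x. indicator B x * f x \<partial>P)"
    using integrable_mult_indicator[OF BP f'(2)] posB
    by (intro nn_integral_eq_integral) simp_all
  also have "\<dots> = ennreal (measure P (A \<inter> B))"
    using f'(3)[OF B] by (simp add: set_lebesgue_integral_def)
  also have "\<dots> = (\<integral>\<^sup>+x. indicator (A \<inter> B) x \<partial>P)"
    using P(3) BP by (simp add: emeasure_eq_measure)
  also have "\<dots> = (\<integral>\<^sup>+x\<in>B. indicator A x \<partial>P)"
    by (rule nn_integral_cong) (auto simp: indicator_def)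
  finally show ?thesis .
qed

text \<open>
  Sufficiency provides common versions for indicators only; linearity and monotone convergence
  extend them to nonnegative functions. The version is described by its integrals over the events
  of \<open>C\<close>, so that these steps reduce to the corresponding rules for the integral under each \<open>P\<close>.
\<close>

lemma sufficient_nn_common_version:
  assumes \<P>: "\<P> \<subseteq> space (prob_algebra M)" and C: "subalgebra M C"
    and suff: "sufficient_for M C \<P>"
    and h: "h \<in> borel_measurable M"
  shows "\<exists>g :: 'a \<Rightarrow> ennreal. g \<in> borel_measurable C \<and>
    (\<forall>P\<in>\<P>. \<forall>B\<in>sets C. (\<integral>\<^sup>+x\<in>B. g x \<partial>P) = (\<integral>\<^sup>+x\<in>B. h x \<partial>P))"
proof -
  have setsP[measurable_cong]: "sets P = sets M" if "P \<in> \<P>" for P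
    using \<P> that by (auto simp: space_prob_algebra)
  have prob: "prob_space P" if "P \<in> \<P>" for P
    using \<P> that by (auto simp: space_prob_algebra)
  have subP: "subalgebra P C" if "P \<in> \<P>" for P
    using subalgebra_law[OF C] \<P> that by auto
  have setP: "B \<in> sets P" if "P \<in> \<P>" "B \<in> sets C" for P B
    using subP[OF that(1)] that(2) by (auto simp: subalgebra_def)
  have CP: "g \<in> borel_measurable P" if "P \<in> \<P>" "g \<in> borel_measurable C" for P and g :: "'a \<Rightarrow> ennreal"
    using measurable_from_subalg[OF subP[OF that(1)] that(2)] .
  have MP: "g \<in> borel_measurable P" if "P \<in> \<P>" "g \<in> borel_measurable M" for P and g :: "'a \<Rightarrow> ennreal"
    using that(2) measurable_cong_sets[OF setsP[OF that(1)] refl] by blast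
  show ?thesis using h
  proof (induction h rule: borel_measurable_induct)
    case (cong f g)
    have eq: "(\<integral>\<^sup>+x\<in>B. f x \<partial>P) = (\<integral>\<^sup>+x\<in>B. g x \<partial>P)" if "P \<in> \<P>" for P B
      by (rule nn_integral_cong)
        (use cong(3) sets_eq_imp_space_eq[OF setsP[OF that]] in auto)
    show ?case using cong(4) eq by simp
  next
    case (set A)
    then obtain f where f: "f \<in> borel_measurable C" "\<forall>P\<in>\<P>. cond_prob_version P C A f"
      using suff unfolding sufficient_for_def by blast
    have "(\<lambda>x. ennreal (f x)) \<in> borel_measurable C" using f(1) by simp
    moreover have "(\<integral>\<^sup>+x\<in>B. ennreal (f x) \<partial>P) = (\<integral>\<^sup>+x\<in>B. indicator A x \<partial>P)"
      if "P \<in> \<P>" "B \<in> sets C" for P B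
      using nn_integral_cond_prob_version[OF prob subP _ _ that(2)] that(1) f(2) set setsP
      by auto
    ultimately show ?case by blast
  next
    case (mult u c)
    then obtain g where g: "g \<in> borel_measurable C"
      "\<And>P B. P \<in> \<P> \<Longrightarrow> B \<in> sets C \<Longrightarrow> (\<integral>\<^sup>+x\<in>B. g x \<partial>P) = (\<integral>\<^sup>+x\<in>B. u x \<partial>P)" by blast
    have "(\<integral>\<^sup>+x\<in>B. c * g x \<partial>P) = (\<integral>\<^sup>+x\<in>B. c * u x \<partial>P)" if "P \<in> \<P>" "B \<in> sets C" for P B
      using g(2)[OF that] CP[OF that(1) g(1)] MP[OF that(1) mult(2)] setP[OF that]
      by (simp add: mult.assoc nn_integral_cmult)
    then show ?case using g(1) by (intro exI[of _ "\<lambda>x. c * g x"]) auto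
  next
    case (add u v)
    then obtain g g' where g: "g \<in> borel_measurable C" "g' \<in> borel_measurable C"
      "\<And>P B. P \<in> \<P> \<Longrightarrow> B \<in> sets C \<Longrightarrow> (\<integral>\<^sup>+x\<in>B. g x \<partial>P) = (\<integral>\<^sup>+x\<in>B. u x \<partial>P)"
      "\<And>P B. P \<in> \<P> \<Longrightarrow> B \<in> sets C \<Longrightarrow> (\<integral>\<^sup>+x\<in>B. g' x \<partial>P) = (\<integral>\<^sup>+x\<in>B. v x \<partial>P)" by blast
    have "(\<integral>\<^sup>+x\<in>B. (g x + g' x) \<partial>P) = (\<integral>\<^sup>+x\<in>B. (v x + u x) \<partial>P)"
      if "P \<in> \<P>" "B \<in> sets C" for P B
      using g(3,4)[OF that] CP[OF that(1) g(1)] CP[OF that(1) g(2)] MP[OF that(1) add(1)]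
        MP[OF that(1) add(3)] setP[OF that]
      by (simp add: distrib_right nn_integral_add add.commute)
    then show ?case using g(1,2) by (intro exI[of _ "\<lambda>x. g x + g' x"]) auto
  next
    case (seq U)
    then obtain G where G: "\<And>n. G n \<in> borel_measurable C"
      "\<And>n P B. P \<in> \<P> \<Longrightarrow> B \<in> sets C \<Longrightarrow> (\<integral>\<^sup>+x\<in>B. G n x \<partial>P) = (\<integral>\<^sup>+x\<in>B. U n x \<partial>P)"
      by metis
    have "(\<integral>\<^sup>+x\<in>B. (SUP n. G n x) \<partial>P) = (\<integral>\<^sup>+x\<in>B. (SUP n. U n) x \<partial>P)"
      if P: "P \<in> \<P>" and B: "B \<in> sets C" for P B
    proof -
      interpret prob_space P using prob[OF P] .
      interpret finite_measure_subalgebra P C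
        by (rule finite_measure_subalgebra.intro) (unfold_locales, rule subP[OF P])
      have [measurable]: "G n \<in> borel_measurable P" "U n \<in> borel_measurable P" "B \<in> sets P" for n
        using CP[OF P G(1)] MP[OF P seq(1)] setP[OF P B] by auto
      \<comment> \<open>The versions \<open>G n\<close> need not increase pointwise, and the exceptional set depends on \<open>P\<close>;
        their supremum is formed everywhere, and monotonicity is needed only \<open>P\<close>-almost surely.\<close>
      have cond: "AE x in P. G n x = nn_cond_exp P C (U n) x" for n
        by (rule nn_cond_exp_charact) (use G P in auto)
      have inc: "AE x in P. G n x \<le> G (Suc n) x" for n
      proof -
        have "AE x in P. nn_cond_exp P C (U n) x \<le> nn_cond_exp P C (U (Suc n)) x"
          by (rule nn_cond_exp_mono) (use incseqD[OF seq(3), of n "Suc n"] in \<open>auto simp: le_fun_def\<close>)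
        then show ?thesis using cond[of n] cond[of "Suc n"] by eventually_elim simp
      qed
      have "(\<integral>\<^sup>+x\<in>B. (SUP n. G n x) \<partial>P) = (\<integral>\<^sup>+x. (SUP n. G n x * indicator B x) \<partial>P)"
        by (simp add: SUP_mult_right_ennreal)
      also have "\<dots> = (SUP n. \<integral>\<^sup>+x\<in>B. G n x \<partial>P)"
      proof (rule nn_integral_monotone_convergence_SUP_AE)
        show "AE x in P. G n x * indicator B x \<le> G (Suc n) x * indicator B x" for n
          using inc[of n] by eventually_elim (rule mult_right_mono, simp_all)
      qed measurable
      also have "\<dots> = (SUP n. \<integral>\<^sup>+x\<in>B. U n x \<partial>P)"
        using G(2)[OF P B] by simp
      also have "\<dots> = (\<integral>\<^sup>+x. (SUP n. U n x * indicator B x) \<partial>P)"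
        using incseqD[OF seq(3), of n "Suc n" for n]
        by (intro nn_integral_monotone_convergence_SUP_AE[symmetric])
          (auto simp: le_fun_def intro!: mult_right_mono)
      also have "\<dots> = (\<integral>\<^sup>+x\<in>B. (SUP n. U n) x \<partial>P)"
        by (simp add: SUP_mult_right_ennreal image_comp)
      finally show ?thesis .
    qed
    moreover have "(\<lambda>x. SUP n. G n x) \<in> borel_measurable C" using G(1) by simp
    ultimately show ?case by blast
  qed
qed

text \<open>
  The version of the positive part is obtained with values in \<open>[0, \<infinity>]\<close>. Integrability of \<open>h\<close> makes it
  finite almost surely, so the default value \<open>enn2real \<infinity> = 0\<close> changes no integral. The family \<open>\<B>\<close>
  stands for the events of the sub-\<open>\<sigma>\<close>-algebra.
\<close>

lemma integral_enn2real_version: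
  fixes g :: "'a \<Rightarrow> ennreal" and h :: "'a \<Rightarrow> real"
  assumes [measurable]: "g \<in> borel_measurable M" "h \<in> borel_measurable M" "B \<in> sets M"
    and h: "integrable M h"
    and eq: "\<And>B. B \<in> \<B> \<Longrightarrow> (\<integral>\<^sup>+x\<in>B. g x \<partial>M) = (\<integral>\<^sup>+x\<in>B. ennreal (h x) \<partial>M)"
    and sp: "space M \<in> \<B>" "B \<in> \<B>"
  shows "integrable M (\<lambda>x. enn2real (g x))"
    and "(\<integral>x\<in>B. enn2real (g x) \<partial>M) = (\<integral>x\<in>B. max 0 (h x) \<partial>M)"
proof -
  have tot: "(\<integral>\<^sup>+x. f x \<partial>M) = (\<integral>\<^sup>+x\<in>space M. f x \<partial>M)" for f :: "'a \<Rightarrow> ennreal"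
    by (rule nn_integral_cong) auto
  have "(\<integral>\<^sup>+x. ennreal (h x) \<partial>M) < \<infinity>"
    using h by (simp add: real_integrable_def less_top[symmetric])
  with eq[OF sp(1)] have "(\<integral>\<^sup>+x. g x \<partial>M) < \<infinity>"
    by (simp only: tot[symmetric])
  then have "AE x in M. g x \<noteq> \<infinity>"
    by (intro nn_integral_PInf_AE) auto
  then have fin: "AE x in M. ennreal (enn2real (g x)) = g x"
    by eventually_elim (simp add: less_top[symmetric])
  have "(\<integral>\<^sup>+x. ennreal (enn2real (g x)) \<partial>M) = (\<integral>\<^sup>+x. g x \<partial>M)"
    by (rule nn_integral_cong_AE[OF fin])
  with \<open>(\<integral>\<^sup>+x. g x \<partial>M) < \<infinity>\<close> show "integrable M (\<lambda>x. enn2real (g x))"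
    by (intro integrableI_nonneg) auto
  have "(\<integral>x\<in>B. enn2real (g x) \<partial>M) = enn2real (\<integral>\<^sup>+x. ennreal (indicator B x * enn2real (g x)) \<partial>M)"
    unfolding set_lebesgue_integral_def by (subst integral_eq_nn_integral) auto
  also have "(\<integral>\<^sup>+x. ennreal (indicator B x * enn2real (g x)) \<partial>M) = (\<integral>\<^sup>+x\<in>B. g x \<partial>M)"
    by (rule nn_integral_cong_AE) (use fin in \<open>eventually_elim, auto simp: indicator_def\<close>)
  also have "\<dots> = (\<integral>\<^sup>+x. ennreal (indicator B x * max 0 (h x)) \<partial>M)"
    unfolding eq[OF sp(2)]
    by (rule nn_integral_cong) (auto simp: indicator_def max_def ennreal_neg)
  also have "enn2real \<dots> = (\<integral>x\<in>B. max 0 (h x) \<partial>M)"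
    unfolding set_lebesgue_integral_def by (subst integral_eq_nn_integral) auto
  finally show "(\<integral>x\<in>B. enn2real (g x) \<partial>M) = (\<integral>x\<in>B. max 0 (h x) \<partial>M)" .
qed

lemma sufficient_common_version:
  fixes h :: "'a \<Rightarrow> real"
  assumes \<P>: "\<P> \<subseteq> space (prob_algebra M)" and C: "subalgebra M C"
    and suff: "sufficient_for M C \<P>"
    and h: "h \<in> borel_measurable M" "\<And>P. P \<in> \<P> \<Longrightarrow> integrable P h"
  shows "\<exists>g. g \<in> borel_measurable C \<and> (\<forall>P\<in>\<P>. integrable P g \<and>
    (\<forall>B\<in>sets C. (\<integral>x\<in>B. g x \<partial>P) = (\<integral>x\<in>B. h x \<partial>P)))"
proof -
  obtain p where p: "p \<in> borel_measurable C"
    "\<And>P B. P \<in> \<P> \<Longrightarrow> B \<in> sets C \<Longrightarrow> (\<integral>\<^sup>+x\<in>B. p x \<partial>P) = (\<integral>\<^sup>+x\<in>B. ennreal (h x) \<partial>P)"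
    using sufficient_nn_common_version[OF \<P> C suff, of "\<lambda>x. ennreal (h x)"] h(1) by auto
  obtain n where n: "n \<in> borel_measurable C"
    "\<And>P B. P \<in> \<P> \<Longrightarrow> B \<in> sets C \<Longrightarrow> (\<integral>\<^sup>+x\<in>B. n x \<partial>P) = (\<integral>\<^sup>+x\<in>B. ennreal (- h x) \<partial>P)"
    using sufficient_nn_common_version[OF \<P> C suff, of "\<lambda>x. ennreal (- h x)"] h(1) by auto
  define g where "g = (\<lambda>x. enn2real (p x) - enn2real (n x))"
  have "integrable P g \<and> (\<integral>x\<in>B. g x \<partial>P) = (\<integral>x\<in>B. h x \<partial>P)" if P: "P \<in> \<P>" and B: "B \<in> sets C" for P B
  proof -
    have sub: "subalgebra P C" using subalgebra_law[OF C] \<P> P by auto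
    have [measurable]: "p \<in> borel_measurable P" "n \<in> borel_measurable P"
      using measurable_from_subalg[OF sub] p(1) n(1) by auto
    have [measurable]: "B \<in> sets P" and spC: "space P \<in> sets C"
      using sub B sets.top[of C] by (auto simp: subalgebra_def)
    have hP: "integrable P h" "integrable P (\<lambda>x. - h x)" using h(2)[OF P] by auto
    note posI = integral_enn2real_version[OF _ _ _ hP(1) p(2)[OF P] spC B]
    note negI = integral_enn2real_version[OF _ _ _ hP(2) n(2)[OF P] spC B]
    have int: "integrable P (\<lambda>x. enn2real (p x))" "integrable P (\<lambda>x. enn2real (n x))"
      using posI(1) negI(1) borel_measurable_integrable[OF hP(1)] by auto
    have setint: "set_integrable P B f" if "integrable P f" for f :: "'a \<Rightarrow> real"
      using that integrable_mult_indicator[of B P f] by (simp add: set_integrable_def)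
    have "(\<integral>x\<in>B. g x \<partial>P) = (\<integral>x\<in>B. max 0 (h x) \<partial>P) - (\<integral>x\<in>B. max 0 (- h x) \<partial>P)"
      unfolding g_def using posI(2) negI(2) borel_measurable_integrable[OF hP(1)]
      by (subst set_integral_diff) (auto intro!: setint int)
    also have "\<dots> = (\<integral>x\<in>B. (max 0 (h x) - max 0 (- h x)) \<partial>P)"
      by (rule set_integral_diff(2)[symmetric]; rule setint) (use hP in auto)
    also have "(\<lambda>x. max 0 (h x) - max 0 (- h x)) = h" by (auto simp: max_def)
    finally show ?thesis using int by (auto simp: g_def)
  qed
  moreover have "g \<in> borel_measurable C" unfolding g_def using p(1) n(1) by measurable
  ultimately show ?thesis using sets.top[of C] by blast
qed

section \<open>Unbiased estimators of zero and neutral events\<close>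

definition unbiased_zero :: "'a measure \<Rightarrow> 'a measure set \<Rightarrow> ('a \<Rightarrow> real) set" where
  "unbiased_zero M \<P> =
    {h \<in> borel_measurable M. \<forall>P\<in>\<P>. integrable P h \<and> (\<integral>x. h x \<partial>P) = 0}"

definition neutral :: "'a measure \<Rightarrow> 'a measure set \<Rightarrow> 'a set set" where
  "neutral M \<P> =
    {A \<in> sets M. \<forall>h \<in> unbiased_zero M \<P>. (\<lambda>x. indicator A x * h x) \<in> unbiased_zero M \<P>}"

lemma neutral_iff_set_integral:
  assumes "\<P> \<subseteq> space (prob_algebra M)"
  shows "A \<in> neutral M \<P> \<longleftrightarrow>
    A \<in> sets M \<and> (\<forall>h \<in> unbiased_zero M \<P>. \<forall>P\<in>\<P>. (\<integral>x\<in>A. h x \<partial>P) = 0)"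
proof -
  have setsP: "sets P = sets M" if "P \<in> \<P>" for P
    using assms that by (auto simp: space_prob_algebra)
  have "integrable P (\<lambda>x. indicator A x * h x)"
    if "A \<in> sets M" "h \<in> unbiased_zero M \<P>" "P \<in> \<P>" for h P
    using that setsP[OF that(3)] integrable_mult_indicator[of A P h] by (auto simp: unbiased_zero_def)
  then show ?thesis
    by (auto simp: neutral_def set_lebesgue_integral_def unbiased_zero_def)
qed

text \<open>
  The completeness argument, carried out inside one submodel: the common version of the conditional
  expectation of \<open>h\<close> is itself an unbiased estimator of zero, now measurable with respect to \<open>C\<close>.
\<close>

lemma complete_sufficient_set_integral_zero:
  assumes \<P>: "\<P> \<subseteq> space (prob_algebra M)" and C: "subalgebra M C"
    and suff: "sufficient_for M C \<P>" and compl: "complete_for C \<P>"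
    and h: "h \<in> unbiased_zero M \<P>" and P: "P \<in> \<P>" and B: "B \<in> sets C"
  shows "(\<integral>x\<in>B. h x \<partial>P) = 0"
proof -
  have hM: "h \<in> borel_measurable M" and hP: "\<And>P. P \<in> \<P> \<Longrightarrow> integrable P h"
    using h by (auto simp: unbiased_zero_def)
  obtain g where g: "g \<in> borel_measurable C" "\<And>P. P \<in> \<P> \<Longrightarrow> integrable P g"
    "\<And>P B. P \<in> \<P> \<Longrightarrow> B \<in> sets C \<Longrightarrow> (\<integral>x\<in>B. g x \<partial>P) = (\<integral>x\<in>B. h x \<partial>P)"
    using sufficient_common_version[OF \<P> C suff hM hP] by auto
  have sub: "subalgebra P C" if "P \<in> \<P>" for P using subalgebra_law[OF C] \<P> that by auto
  have "(\<integral>x. g x \<partial>P) = 0" if "P \<in> \<P>" for P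
  proof -
    have sp: "space P \<in> sets C"
      using sub[OF that] sets.top[of C] by (auto simp: subalgebra_def)
    have "(\<integral>x. g x \<partial>P) = (\<integral>x. h x \<partial>P)"
      using g(3)[OF that sp] g(2)[OF that] h that
      by (simp add: set_integral_space unbiased_zero_def)
    then show ?thesis using h that by (simp add: unbiased_zero_def)
  qed
  with compl g(1,2) P have "AE x in P. g x = 0" unfolding complete_for_def by blast
  then have "(\<integral>x\<in>B. g x \<partial>P) = 0"
    unfolding set_lebesgue_integral_def by (intro integral_eq_zero_AE) auto
  with g(3)[OF P B] show ?thesis by simp
qed

text \<open>
  Intersections come for free because neutrality quantifies over the whole class of unbiased
  estimators of zero: if \<open>h\<close> belongs to the class, so does \<open>h\<close> times the indicator of \<open>B\<close>, and neutrality of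
  \<open>A\<close> applies to this product. The Dynkin system of neutral events is therefore a \<open>\<sigma>\<close>-algebra.
\<close>

lemma sigma_algebra_neutral:
  assumes \<P>: "\<P> \<subseteq> space (prob_algebra M)"
  shows "sigma_algebra (space M) (neutral M \<P>)"
proof -
  note iff = neutral_iff_set_integral[OF \<P>]
  have setsP: "sets P = sets M" if "P \<in> \<P>" for P
    using \<P> that by (auto simp: space_prob_algebra)
  note spP = sets_eq_imp_space_eq[OF setsP]
  have setint: "set_integrable P A h"
    if "A \<in> sets M" "h \<in> unbiased_zero M \<P>" "P \<in> \<P>" for A h P
    using that integrable_mult_indicator[of A P h] setsP[OF that(3)]
    by (auto simp: unbiased_zero_def set_integrable_def)
  have tot: "(\<integral>x\<in>space M. h x \<partial>P) = 0" if "h \<in> unbiased_zero M \<P>" "P \<in> \<P>" for h P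
    using that spP[OF that(2)] set_integral_space[of P h] by (auto simp: unbiased_zero_def)
  interpret Dynkin_system "space M" "neutral M \<P>"
  proof (rule Dynkin_systemI)
    show "A \<subseteq> space M" if "A \<in> neutral M \<P>" for A
      using that sets.sets_into_space by (auto simp: neutral_def)
    show "space M \<in> neutral M \<P>" unfolding iff using tot by auto
    show "space M - A \<in> neutral M \<P>" if A: "A \<in> neutral M \<P>" for A
      unfolding iff
    proof (intro conjI ballI)
      show AM: "space M - A \<in> sets M" using A by (auto simp: neutral_def)
      fix h P assume hP: "h \<in> unbiased_zero M \<P>" "P \<in> \<P>"
      have "A \<in> sets M" using A by (auto simp: neutral_def)
      then have "(\<integral>x\<in>(space M - A) \<union> A. h x \<partial>P) = (\<integral>x\<in>space M - A. h x \<partial>P) + (\<integral>x\<in>A. h x \<partial>P)"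
        using AM hP by (intro set_integral_Un setint) auto
      moreover have "(space M - A) \<union> A = space M"
        using sets.sets_into_space[OF \<open>A \<in> sets M\<close>] by auto
      ultimately show "(\<integral>x\<in>space M - A. h x \<partial>P) = 0"
        using tot[OF hP] A hP iff by auto
    qed
    show "(\<Union>i::nat. A i) \<in> neutral M \<P>" if A: "disjoint_family A" "range A \<subseteq> neutral M \<P>" for A
      unfolding iff
    proof (intro conjI ballI)
      have Ai: "A i \<in> sets M" for i using A(2) by (auto simp: neutral_def)
      then show AM: "(\<Union>i. A i) \<in> sets M" by auto
      fix h P assume hP: "h \<in> unbiased_zero M \<P>" "P \<in> \<P>"
      have "(\<integral>x\<in>(\<Union>i. A i). h x \<partial>P) = (\<Sum>i. (\<integral>x\<in>A i. h x \<partial>P))"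
        by (rule lebesgue_integral_countable_add)
          (use Ai setsP[OF hP(2)] A(1) setint[OF AM hP] in \<open>auto simp: disjoint_family_on_def\<close>)
      also have "\<dots> = 0"
      proof -
        have "(\<integral>x\<in>A i. h x \<partial>P) = 0" for i using A(2) hP iff[of "A i"] by auto
        then show ?thesis by simp
      qed
      finally show "(\<integral>x\<in>(\<Union>i. A i). h x \<partial>P) = 0" .
    qed
  qed
  have "Int_stable (neutral M \<P>)"
  proof (rule Int_stableI)
    fix A B assume AB: "A \<in> neutral M \<P>" "B \<in> neutral M \<P>"
    have "(\<lambda>x. indicator (A \<inter> B) x * h x) \<in> unbiased_zero M \<P>" if "h \<in> unbiased_zero M \<P>" for h
    proof -
      have "(\<lambda>x. indicator A x * (indicator B x * h x)) \<in> unbiased_zero M \<P>"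
        using AB that by (auto simp: neutral_def)
      then show ?thesis by (simp add: indicator_inter_arith mult.assoc)
    qed
    then show "A \<inter> B \<in> neutral M \<P>" using AB by (auto simp: neutral_def)
  qed
  then show ?thesis using sigma_algebra_eq_Int_stable by simp
qed

lemma sigma_join_neutral:
  assumes \<P>: "\<P> \<subseteq> space (prob_algebra M)" and C: "\<And>i. i \<in> I \<Longrightarrow> sets (C i) \<subseteq> neutral M \<P>"
  shows "sets (sigma_join M I C) \<subseteq> neutral M \<P>"
proof -
  have "(\<Union>i\<in>I. sets (C i)) \<subseteq> neutral M \<P>" using C by auto
  moreover have "neutral M \<P> \<subseteq> Pow (space M)"
    using sets.sets_into_space by (auto simp: neutral_def)
  ultimately show ?thesis
    using sigma_algebra.sigma_sets_subset[OF sigma_algebra_neutral[OF \<P>], of "\<Union>i\<in>I. sets (C i)"]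
    by (simp add: sigma_join_def)
qed

section \<open>Completeness of the join\<close>

text \<open>
  The sign events of a \<open>D\<close>-measurable \<open>h\<close> lie in \<open>D\<close>. If they are neutral, then the positive and the
  negative part of \<open>h\<close> both have integral \<open>0\<close>, and a nonnegative function with integral \<open>0\<close> is
  almost surely \<open>0\<close>.
\<close>

lemma complete_for_if_neutral:
  assumes \<P>: "\<P> \<subseteq> space (prob_algebra M)" and sp: "space D = space M" and D: "sets D \<subseteq> neutral M \<P>"
  shows "complete_for D \<P>"
  unfolding complete_for_def
proof (intro allI impI ballI)
  fix h :: "'a \<Rightarrow> real" and P
  assume hD: "h \<in> borel_measurable D" and int: "\<forall>P\<in>\<P>. integrable P h"
    and zero: "\<forall>P\<in>\<P>. (\<integral>x. h x \<partial>P) = 0" and P: "P \<in> \<P>"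
  have sub: "subalgebra M D" using sp D by (auto simp: subalgebra_def neutral_def)
  have subP: "subalgebra P D" using subalgebra_law[OF sub] \<P> P by auto
  have h: "h \<in> unbiased_zero M \<P>"
    using measurable_from_subalg[OF sub hD] int zero by (auto simp: unbiased_zero_def)
  \<comment> \<open>The values \<open>s = 1\<close> and \<open>s = -1\<close> treat the events \<open>h > 0\<close> and \<open>h < 0\<close> alike.\<close>
  have part: "AE x in P. \<not> 0 < s * h x" if "s \<noteq> 0" for s :: real
  proof -
    define B where "B = {x \<in> space D. 0 < s * h x}"
    have B: "B \<in> sets D" unfolding B_def using hD by measurable
    then have BP: "B \<in> sets P" using subP by (auto simp: subalgebra_def)
    have "(\<integral>x\<in>B. h x \<partial>P) = 0" using B D h P neutral_iff_set_integral[OF \<P>] by blast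
    then have "(\<integral>x. s * (indicator B x * h x) \<partial>P) = 0"
      by (simp add: set_lebesgue_integral_def)
    moreover have "integrable P (\<lambda>x. s * (indicator B x * h x))"
      using integrable_mult_indicator[OF BP, of h] int P by auto
    moreover have "AE x in P. 0 \<le> s * (indicator B x * h x)"
      by (auto simp: B_def indicator_def)
    ultimately have "AE x in P. s * (indicator B x * h x) = 0"
      using integral_nonneg_eq_0_iff_AE by blast
    moreover have "AE x in P. x \<in> space D"
      using subP AE_space[of P] by (simp add: subalgebra_def)
    ultimately show ?thesis
      by eventually_elim (auto simp: B_def indicator_def split: if_splits)
  qed
  show "AE x in P. h x = 0" using part[of 1] part[of "-1"] by auto
qed

theorem theorem1p1:
  fixes M :: "'a measure"
    and \<P> :: "'a measure set"
    and I :: "'i set"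
    and C :: "'i \<Rightarrow> 'a measure"
    and H :: "'i \<Rightarrow> 'h set"
    and \<Q> :: "'i \<Rightarrow> 'h \<Rightarrow> 'a measure set"
  assumes "model M \<P>"
    and "\<And>i. i \<in> I \<Longrightarrow> subalgebra M (C i)"
    and "\<And>i. i \<in> I \<Longrightarrow> exhaustion \<P> (H i) (\<Q> i)"
    and "\<And>i \<eta>. i \<in> I \<Longrightarrow> \<eta> \<in> H i \<Longrightarrow> complete_for (C i) (\<Q> i \<eta>)"
    and "\<And>i \<eta>. i \<in> I \<Longrightarrow> \<eta> \<in> H i \<Longrightarrow> sufficient_for M (C i) (\<Q> i \<eta>)"
  shows "complete_for (sigma_join M I C) \<P>"
proof (rule complete_for_if_neutral)
  show \<P>: "\<P> \<subseteq> space (prob_algebra M)" using assms(1) by (simp add: model_def)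
  show "space (sigma_join M I C) = space M"
    by (simp add: sigma_join_def space_measure_of_conv)
  show "sets (sigma_join M I C) \<subseteq> neutral M \<P>"
  proof (rule sigma_join_neutral[OF \<P>], rule subsetI)
    fix i B assume i: "i \<in> I" and B: "B \<in> sets (C i)"
    have "(\<integral>x\<in>B. h x \<partial>P) = 0" if h: "h \<in> unbiased_zero M \<P>" and P: "P \<in> \<P>" for h P
    proof -
      obtain \<eta> where \<eta>: "\<eta> \<in> H i" "P \<in> \<Q> i \<eta>" "\<Q> i \<eta> \<subseteq> \<P>"
        using assms(3)[OF i] P unfolding exhaustion_def by blast
      have "h \<in> unbiased_zero M (\<Q> i \<eta>)" using h \<eta>(3) by (auto simp: unbiased_zero_def)
      then show ?thesis
        using complete_sufficient_set_integral_zero[OF _ assms(2)[OF i] assms(5)[OF i \<eta>(1)]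
            assms(4)[OF i \<eta>(1)] _ \<eta>(2) B] \<eta>(3) \<P> by auto
    qed
    then show "B \<in> neutral M \<P>"
      unfolding neutral_iff_set_integral[OF \<P>]
      using B assms(2)[OF i] by (auto simp: subalgebra_def)
  qed
qed

end
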